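(* Suppose $\rho:\Gamma\to\mathrm{GL}(d,\mathbb R)$ is $1$-almost dominated relative to $\mathcal P$. For any non-peripheral $\gamma\in\Gamma$, $\rho(\gamma)$ must be proximal (i.e. $\rho(\gamma)$ has a unique eigenvalue of maximal modulus, and it is simple).
   Context: Setting. $\Gamma$ is a finitely generated torsion-free group, $\mathcal P$ is a finite collection of finitely generated proper infinite subgroups of $\Gamma$, and $S=S^{-1}$ is a finite generating set of $\Gamma$ such that $S\cap P$ generates $P$ for each $P\in\mathcal P$. Conjugates of elements of $\mathcal P$ are called peripheral subgroups. An element of $\Gamma$ is peripheral if it lies in a peripheral subgroup, and non-peripheral otherwise. The left cosets $gP$ ($g\in\Gamma$, $P\in\mathcal P$) are the peripheral cosets. Cusped space. The combinatorial horoball $\mathcal H(\Lambda)$ on a graph $\Lambda$ is the graph with vertex set $\Lambda^{(0)}\times\mathbb Z_{\ge 0}$, a horizontal edge between $(v,k)$ and $(w,k)$ whenever $0<d_\Lambda(v,w)\le 2^k$, and a vertical edge between $(v,k)$ and $(v,k+1)$; all edges have length $1$. The cusped space $X=X(\Gamma,\mathcal P,S)$ is obtained from the Cayley graph $\mathrm{Cay}(\Gamma)=\mathrm{Cay}(\Gamma,S)$ by gluing a combinatorial horoball $\mathcal H(tP)$ on each peripheral coset $tP\subset \mathrm{Cay}(\Gamma)$ along its level $0$. $d_c$ is the path metric on $X$, $|\gamma|_c:=d_c(\mathrm{id},\gamma)$, and $|\gamma|$ is the word length with respect to $S$. Paths. A peripheral excursion of a path in $X$ is a maximal subpath lying in a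 closed combinatorial horoball. A preferred geodesic in a horoball is a geodesic consisting of at most two vertical segments and a single horizontal segment of length at most $3$. If $\hat\gamma:I\to X$ is a path with endpoints (if any) in $\mathrm{Cay}(\Gamma)$ whose peripheral excursions are preferred geodesics, its projection $\pi\circ\hat\gamma:I\to\mathrm{Cay}(\Gamma)$ replaces each excursion by a geodesic path with the same endpoints in the Cayley graph of the corresponding peripheral coset (omit the vertical segments and replace the horizontal segment by the corresponding segment at level $0$, run at constant speed). If $\hat\gamma$ is geodesic, $\pi\circ\hat\gamma$ is called a projected geodesic. For a path $\gamma:I\to\mathrm{Cay}(\Gamma)$ where $I$ has integer (or infinite) endpoints and $\gamma(I\cap\mathbb Z)\subset\Gamma$, the depth $\delta(n)$ of $\gamma(n)$ is the smallest integer $d$ such that at least one of $\gamma(n-d),\gamma(n+d)$ is defined and not in the same peripheral coset as $\gamma(n)$, or, if there is no such integer, $\min\{\sup I-n,\,n-\inf I\}$. For $\underline\upsilon,\overline\upsilon>0$, $\gamma$ is a $(\underline\upsilon,\overline\upsilon)$-metric quasigeodesic path if for all integers $m,n\in I$: (i) $|\gamma(n)^{-1}\gamma(m)|_c\ge\underline\upsilon^{-1}|m-n|-\underline\upsilon$; (ii) $|\gamma(n)^{-1}\gamma(m)|_c\le\overline\upsilon(|m-n|+\min\{\delta(m),\delta(n)\})+\overline\upsilon$; (iii) if $\gamma(n)^{-1}\gamma(n+1)\in P$ for some $P\in\mathcal P$, then $\gamma(n)^{-1}\gamma(n+1)=p_{n,1}\cdots p_{n,\ell(n)}$ with each $p_{n,i}$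 a peripheral generator of $P$ and $2^{\delta(n)-1}\le\ell(n)=|\gamma(n)^{-1}\gamma(n+1)|\le 2^{\delta(n)+1}$. Words are regarded as the (suitably parametrized) paths they trace in $\mathrm{Cay}(\Gamma)$. Condition (RH) on $\mathcal P$ (assumed throughout): (malnormality) for $\gamma\in\Gamma$ and $P,P'\in\mathcal P$, $\gamma P\gamma^{-1}\cap P'=1$ unless $\gamma\in P=P'$; (non-distortion) there is $\nu>0$ with $|\gamma^n|_c\ge\nu|n|$ for every infinite-order non-peripheral $\gamma$; (local-to-global) there are $\underline\upsilon,\overline\upsilon,L>0$ such that if $p=p_1\cdots p_n$ is a geodesic word in some $P\in\mathcal P$, $n>L$, and $\gamma p_1\cdots p_L$ is a projected geodesic, then $\gamma p$ is a $(\underline\upsilon,\overline\upsilon)$-metric quasigeodesic path. For $g\in \mathrm{GL}(d,\mathbb R)$, $\sigma_1(g)\ge\dots\ge\sigma_d(g)$ are the singular values. $\rho$ is $1$-almost dominated relative to $\mathcal P$ (with lower domination constants $\underline C,\underline\mu>0$) if $\mathcal P$ satisfies (RH) and $\frac{\sigma_1}{\sigma_2}(\rho(\gamma))\ge\underline Ce^{\underline\mu|\gamma|_c}$ for all $\gamma\in\Gamma$. *)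

theory Defs
  imports
    Complex_Main
    "HOL-Algebra.Algebra"
    "HOL-Computational_Algebra.Polynomial"
    "Jordan_Normal_Form.Char_Poly"
begin

section \<open>Graphs, geodesics and combinatorial horoballs\<close>

text \<open>A graph is given by a symmetric edge relation, and an edge path by the list of its vertices.
  The distance is only meaningful for points in the same component; every graph to which it is
  applied below (Cayley graph, peripheral cosets, horoballs, cusped space) is connected.\<close>

definition gdist :: "('v \<times> 'v) set \<Rightarrow> 'v \<Rightarrow> 'v \<Rightarrow> nat" where
  "gdist E x y = (LEAST n. (x, y) \<in> E ^^ n)"

definition edge_path :: "('v \<times> 'v) set \<Rightarrow> 'v list \<Rightarrow> bool" where
  "edge_path E xs \<longleftrightarrow> xs \<noteq> [] \<and> successively (\<lambda>x y. (x, y) \<in> E) xs"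

definition geodesic :: "('v \<times> 'v) set \<Rightarrow> 'v list \<Rightarrow> bool" where
  "geodesic E xs \<longleftrightarrow> edge_path E xs \<and> length xs = Suc (gdist E (hd xs) (last xs))"

definition horoball_horizontal :: "'v set \<Rightarrow> ('v \<times> 'v) set \<Rightarrow> (('v \<times> nat) \<times> ('v \<times> nat)) set" where
  "horoball_horizontal V E =
     {((v, k), (w, k)) | v w k. v \<in> V \<and> w \<in> V \<and> 0 < gdist E v w \<and> gdist E v w \<le> 2 ^ k}"

definition horoball_vertical :: "'v set \<Rightarrow> (('v \<times> nat) \<times> ('v \<times> nat)) set" where
  "horoball_vertical V = {((v, k), (v, Suc k)) | v k. v \<in> V} \<union> {((v, Suc k), (v, k)) | v k. v \<in> V}"

definition horoball :: "'v set \<Rightarrow> ('v \<times> 'v) set \<Rightarrow> (('v \<times> nat) \<times> ('v \<times> nat)) set" where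
  "horoball V E = horoball_horizontal V E \<union> horoball_vertical V"

text \<open>At most one vertical segment before and one after a horizontal segment of length \<open>j - i \<le> 3\<close>;
  each of the three segments may be degenerate.\<close>

definition preferred_geodesic :: "'v set \<Rightarrow> ('v \<times> 'v) set \<Rightarrow> ('v \<times> nat) list \<Rightarrow> bool" where
  "preferred_geodesic V E ys \<longleftrightarrow> geodesic (horoball V E) ys \<and>
     (\<exists>i j. i \<le> j \<and> j < length ys \<and> j - i \<le> 3 \<and>
        (\<forall>k<i. (ys ! k, ys ! Suc k) \<in> horoball_vertical V) \<and>
        (\<forall>k. i \<le> k \<and> k < j \<longrightarrow> (ys ! k, ys ! Suc k) \<in> horoball_horizontal V E) \<and>
        (\<forall>k. j \<le> k \<and> Suc k < length ys \<longrightarrow> (ys ! k, ys ! Suc k) \<in> horoball_vertical V))"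

section \<open>The cusped space of a group with peripheral subgroups\<close>

text \<open>\<open>Horo C v k\<close>, used with \<open>k > 0\<close>, is the vertex \<open>(v, k)\<close> of the horoball on the peripheral
  coset \<open>C\<close>; a vertex \<open>(v, 0)\<close> is identified with the vertex \<open>Cay v\<close> of the Cayley graph.\<close>

datatype 'g cusped_vertex = Cay 'g | Horo "'g set" 'g nat

fun glue :: "'g set \<Rightarrow> 'g \<times> nat \<Rightarrow> 'g cusped_vertex" where
  "glue C (v, k) = (if k = 0 then Cay v else Horo C v k)"

text \<open>Finite generation of the group and of the peripheral subgroups is part of \<open>S_generates\<close> and
  \<open>P_generated\<close>, since \<open>S\<close> is finite.\<close>

locale group_with_peripherals = group G for G (structure) +
  fixes S :: "'a set" and \<P> :: "'a set set"
  assumes torsion_free: "\<And>x n. \<lbrakk>x \<in> carrier G; x \<noteq> \<one>; 0 < n\<rbrakk> \<Longrightarrow> x [^] (n::nat) \<noteq> \<one>"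
    and S_finite: "finite S"
    and S_subset: "S \<subseteq> carrier G"
    and S_symmetric: "m_inv G ` S = S"
    and S_generates: "generate G S = carrier G"
    and finite_peripherals: "finite \<P>"
    and P_subgroup: "\<And>P. P \<in> \<P> \<Longrightarrow> subgroup P G"
    and P_proper: "\<And>P. P \<in> \<P> \<Longrightarrow> P \<noteq> carrier G"
    and P_infinite: "\<And>P. P \<in> \<P> \<Longrightarrow> infinite P"
    and P_generated: "\<And>P. P \<in> \<P> \<Longrightarrow> generate G (S \<inter> P) = P"
begin

definition peripheral :: "'a \<Rightarrow> bool" where
  "peripheral x \<longleftrightarrow> (\<exists>g\<in>carrier G. \<exists>P\<in>\<P>. x \<in> (g <# P) #> inv g)"

definition peripheral_cosets :: "'a set set" where
  "peripheral_cosets = {g <# P | g P. g \<in> carrier G \<and> P \<in> \<P>}"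

definition same_coset :: "'a \<Rightarrow> 'a \<Rightarrow> bool" where
  "same_coset x y \<longleftrightarrow> (\<exists>C\<in>peripheral_cosets. x \<in> C \<and> y \<in> C)"

definition cayley_graph :: "('a \<times> 'a) set" where
  "cayley_graph = {(x, x \<otimes> s) | x s. x \<in> carrier G \<and> s \<in> S}"

text \<open>For a coset \<open>C = tP\<close> the full subgraph of the Cayley graph on \<open>C\<close> is the translate by \<open>t\<close> of
  the Cayley graph of \<open>P\<close> with respect to \<open>S \<inter> P\<close>.\<close>

definition coset_graph :: "'a set \<Rightarrow> ('a \<times> 'a) set" where
  "coset_graph C = cayley_graph \<inter> C \<times> C"

definition cusped_space :: "('a cusped_vertex \<times> 'a cusped_vertex) set" where
  "cusped_space = map_prod Cay Cay ` cayley_graph \<union>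
     (\<Union>C\<in>peripheral_cosets. map_prod (glue C) (glue C) ` horoball C (coset_graph C))"

definition cusped_length :: "'a \<Rightarrow> nat" where
  "cusped_length x = gdist cusped_space (Cay \<one>) (Cay x)"

definition word_prod :: "'a list \<Rightarrow> 'a" where
  "word_prod w = foldr (\<otimes>) w \<one>"

text \<open>Word length with respect to \<open>T\<close>, which will be \<open>S\<close> or \<open>S \<inter> P\<close>; these sets are symmetric, so no
  inverse letters are needed.\<close>

definition word_length :: "'a set \<Rightarrow> 'a \<Rightarrow> nat" where
  "word_length T x = (LEAST n. \<exists>w\<in>lists T. length w = n \<and> word_prod w = x)"

definition geodesic_word :: "'a set \<Rightarrow> 'a list \<Rightarrow> bool" where
  "geodesic_word T w \<longleftrightarrow> w \<in> lists T \<and> length w = word_length T (word_prod w)"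

subsection \<open>Projected geodesics\<close>

definition closed_horoball :: "'a set \<Rightarrow> 'a cusped_vertex set" where
  "closed_horoball C = glue C ` (C \<times> UNIV)"

text \<open>The subpath of \<open>xs\<close> between the positions \<open>i\<close> and \<open>j\<close> is a peripheral excursion.\<close>

definition excursion :: "'a cusped_vertex list \<Rightarrow> 'a set \<Rightarrow> nat \<Rightarrow> nat \<Rightarrow> bool" where
  "excursion xs C i j \<longleftrightarrow> C \<in> peripheral_cosets \<and> i \<le> j \<and> j < length xs \<and>
     (\<forall>k. i \<le> k \<and> k \<le> j \<longrightarrow> xs ! k \<in> closed_horoball C) \<and>
     (0 < i \<longrightarrow> xs ! (i - 1) \<notin> closed_horoball C) \<and>
     (Suc j < length xs \<longrightarrow> xs ! Suc j \<notin> closed_horoball C)"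

definition excursions_preferred :: "'a cusped_vertex list \<Rightarrow> bool" where
  "excursions_preferred xs \<longleftrightarrow> (\<forall>C i j. excursion xs C i j \<longrightarrow>
     (\<exists>ys. preferred_geodesic C (coset_graph C) ys \<and>
           take (Suc j - i) (drop i xs) = map (glue C) ys))"

text \<open>\<open>projects_upto xs n zs\<close>: the edge path \<open>zs\<close> in the Cayley graph is obtained from the initial part
  of \<open>xs\<close> up to position \<open>n\<close> by keeping the edges outside of all closed horoballs and replacing each
  excursion by a geodesic of the corresponding coset graph.  Parametrizations are ignored.\<close>

inductive projects_upto :: "'a cusped_vertex list \<Rightarrow> nat \<Rightarrow> 'a list \<Rightarrow> bool"
  for xs :: "'a cusped_vertex list" where
  start: "xs \<noteq> [] \<Longrightarrow> xs ! 0 = Cay z \<Longrightarrow> projects_upto xs 0 [z]"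
| edge: "projects_upto xs i zs \<Longrightarrow> Suc i < length xs \<Longrightarrow> xs ! Suc i = Cay z \<Longrightarrow>
    \<not> same_coset (last zs) z \<Longrightarrow> projects_upto xs (Suc i) (zs @ [z])"
| excurs: "projects_upto xs i zs \<Longrightarrow> excursion xs C i j \<Longrightarrow> i < j \<Longrightarrow> geodesic (coset_graph C) us \<Longrightarrow>
    hd us = last zs \<Longrightarrow> xs ! j = Cay (last us) \<Longrightarrow> projects_upto xs j (zs @ tl us)"

definition projected_geodesic :: "'a list \<Rightarrow> bool" where
  "projected_geodesic zs \<longleftrightarrow> (\<exists>xs. geodesic cusped_space xs \<and> excursions_preferred xs \<and>
     projects_upto xs (length xs - 1) zs)"

subsection \<open>Metric quasigeodesic paths\<close>

text \<open>Only the values at integers of a path \<open>[0, N] \<rightarrow> Cay G\<close> matter below, so it is given by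
  \<open>f 0, \<dots>, f N\<close>.  (All paths considered come from finite words.)\<close>

definition leaves_coset :: "nat \<Rightarrow> (nat \<Rightarrow> 'a) \<Rightarrow> nat \<Rightarrow> nat \<Rightarrow> bool" where
  "leaves_coset N f n r \<longleftrightarrow>
     r \<le> n \<and> \<not> same_coset (f n) (f (n - r)) \<or> n + r \<le> N \<and> \<not> same_coset (f n) (f (n + r))"

definition depth :: "nat \<Rightarrow> (nat \<Rightarrow> 'a) \<Rightarrow> nat \<Rightarrow> nat" where
  "depth N f n = (if \<exists>r. leaves_coset N f n r then LEAST r. leaves_coset N f n r
                  else min (N - n) n)"

definition metric_quasigeodesic :: "real \<Rightarrow> real \<Rightarrow> nat \<Rightarrow> (nat \<Rightarrow> 'a) \<Rightarrow> bool" where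
  "metric_quasigeodesic \<upsilon>l \<upsilon>u N f \<longleftrightarrow>
     (\<forall>n\<le>N. f n \<in> carrier G) \<and>
     (\<forall>m\<le>N. \<forall>n\<le>N. real (cusped_length (inv (f n) \<otimes> f m)) \<ge> \<bar>real m - real n\<bar> / \<upsilon>l - \<upsilon>l) \<and>
     (\<forall>m\<le>N. \<forall>n\<le>N. real (cusped_length (inv (f n) \<otimes> f m))
        \<le> \<upsilon>u * (\<bar>real m - real n\<bar> + real (min (depth N f m) (depth N f n))) + \<upsilon>u) \<and>
     (\<forall>n<N. \<forall>P\<in>\<P>. inv (f n) \<otimes> f (Suc n) \<in> P \<longrightarrow>
        (\<exists>w\<in>lists (S \<inter> P). word_prod w = inv (f n) \<otimes> f (Suc n) \<and>
           length w = word_length S (inv (f n) \<otimes> f (Suc n)) \<and>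
           2 powr (real (depth N f n) - 1) \<le> real (length w) \<and>
           real (length w) \<le> 2 powr (real (depth N f n) + 1)))"

text \<open>The path traced by a word is based at the identity; all notions are invariant under left
  translation.\<close>

definition trace_word :: "'a list \<Rightarrow> nat \<Rightarrow> 'a" where
  "trace_word w n = word_prod (take n w)"

definition trace_list :: "'a list \<Rightarrow> 'a list" where
  "trace_list w = map (trace_word w) [0..<Suc (length w)]"

text \<open>A word is regarded as a suitably parametrized path: integer time \<open>n\<close> is at the vertex with
  number \<open>t n\<close> along the word.\<close>

definition word_metric_quasigeodesic :: "real \<Rightarrow> real \<Rightarrow> 'a list \<Rightarrow> bool" where
  "word_metric_quasigeodesic \<upsilon>l \<upsilon>u w \<longleftrightarrow> (\<exists>N t. mono_on {..N} t \<and> t 0 = 0 \<and> t N = length w \<and>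
     metric_quasigeodesic \<upsilon>l \<upsilon>u N (\<lambda>n. trace_word w (t n)))"

subsection \<open>Condition (RH)\<close>

definition malnormality :: bool where
  "malnormality \<longleftrightarrow> (\<forall>x\<in>carrier G. \<forall>P\<in>\<P>. \<forall>P'\<in>\<P>. \<not> (x \<in> P \<and> P = P') \<longrightarrow>
     ((x <# P) #> inv x) \<inter> P' = {\<one>})"

definition non_distortion :: bool where
  "non_distortion \<longleftrightarrow> (\<exists>\<nu>>0. \<forall>x\<in>carrier G.
     (\<forall>k>0. x [^] (k::nat) \<noteq> \<one>) \<and> \<not> peripheral x \<longrightarrow>
     (\<forall>n::int. real (cusped_length (x [^] n)) \<ge> \<nu> * real_of_int \<bar>n\<bar>))"

definition local_to_global :: bool where
  "local_to_global \<longleftrightarrow> (\<exists>\<upsilon>l>0. \<exists>\<upsilon>u>0. \<exists>L>0. \<forall>P\<in>\<P>. \<forall>p w.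
     geodesic_word (S \<inter> P) p \<and> L < length p \<and> w \<in> lists S \<and>
     projected_geodesic (trace_list (w @ take L p)) \<longrightarrow>
     word_metric_quasigeodesic \<upsilon>l \<upsilon>u (w @ p))"

definition RH :: bool where
  "RH \<longleftrightarrow> malnormality \<and> non_distortion \<and> local_to_global"

end

section \<open>Linear representations\<close>

definition GL :: "nat \<Rightarrow> real mat monoid" where
  "GL d = units_of (ring_mat TYPE(real) d ())"

text \<open>The singular values in nonincreasing order, with multiplicity: the square roots of the
  eigenvalues of \<open>A\<^sup>T A\<close>.  Numbering starts at 1.\<close>

definition singular_value :: "nat \<Rightarrow> real mat \<Rightarrow> real" where
  "singular_value k A =
     rev (sorted_list_of_multiset (image_mset sqrt (proots (char_poly (transpose_mat A * A))))) ! (k - 1)"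

definition proximal :: "real mat \<Rightarrow> bool" where
  "proximal A \<longleftrightarrow> (let B = map_mat complex_of_real A in
     \<exists>z. eigenvalue B z \<and> order z (char_poly B) = 1 \<and>
         (\<forall>z'. eigenvalue B z' \<and> z' \<noteq> z \<longrightarrow> cmod z' < cmod z))"

definition (in group_with_peripherals) one_almost_dominated :: "('a \<Rightarrow> real mat) \<Rightarrow> bool" where
  "one_almost_dominated \<rho> \<longleftrightarrow> RH \<and> (\<exists>C>0. \<exists>\<mu>>0. \<forall>x\<in>carrier G.
     singular_value 1 (\<rho> x) / singular_value 2 (\<rho> x) \<ge> C * exp (\<mu> * real (cusped_length x)))"

end

theory Submission
  imports Defs "Jordan_Normal_Form.Spectral_Radius"
begin

text \<open>Let \<open>A = \<rho> \<gamma>\<close>. By torsion-freeness and non-distortion, \<open>\<sigma>\<^sub>1/\<sigma>\<^sub>2 (A\<^sup>N)\<close> grows exponentially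
  in \<open>N\<close>. If \<open>A\<close> is not proximal, it has two eigenvalues \<open>\<alpha>, \<mu>\<close> (counted with multiplicity) of the
  same maximal modulus \<open>r\<close>, and a complex invariant plane on which they occur; the action on the
  exterior square of that plane shows that the sum of squares of the 2x2 minors of \<open>A\<^sup>N\<close> is at
  least a constant times \<open>r\<^sup>4\<^sup>N\<close>. This sum is twice \<open>(tr B)\<^sup>2 - tr B\<^sup>2\<close> for \<open>B = (A\<^sup>N)\<^sup>T A\<^sup>N\<close>, hence
  at most a constant times \<open>(\<sigma>\<^sub>1 \<sigma>\<^sub>2)\<^sup>2\<close>. As \<open>\<sigma>\<^sub>1 (A\<^sup>N)\<close> is at most \<open>r\<^sup>N\<close> times a polynomial in \<open>N\<close>, the
  ratio \<open>\<sigma>\<^sub>1/\<sigma>\<^sub>2 = \<sigma>\<^sub>1\<^sup>2 / (\<sigma>\<^sub>1 \<sigma>\<^sub>2)\<close> would grow at most polynomially.\<close>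

section \<open>Spectrum of Gram matrices\<close>

text \<open>The transpose of a real matrix is its adjoint, so pairing \<open>B v = e v\<close> with
  the conjugate of \<open>v\<close> gives e |v|^2 = |M v|^2. Below, \<open>?N\<close> is |v|^2 and
  \<open>?w\<close> lists the coordinates of \<open>M v\<close>.\<close>

lemma gram_eigenvalue_nonneg_real:
  fixes M :: "real mat"
  assumes M: "M \<in> carrier_mat n n"
    and ev: "eigenvalue (map_mat complex_of_real (transpose_mat M * M)) e"
  shows "\<exists>r\<ge>0. e = complex_of_real r"
proof -
  let ?B = "map_mat complex_of_real (transpose_mat M * M)"
  let ?m = "\<lambda>k i. complex_of_real (M $$ (k, i))"
  from ev obtain v where v: "v \<in> carrier_vec n" "v \<noteq> 0\<^sub>v n" and Bv: "?B *\<^sub>v v = e \<cdot>\<^sub>v v"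
    using M unfolding eigenvalue_def eigenvector_def by auto
  let ?N = "\<Sum>i<n. (cmod (v $ i))\<^sup>2"
  let ?w = "\<lambda>k. \<Sum>j<n. ?m k j * v $ j"
  have entry: "(\<Sum>j<n. (\<Sum>k<n. ?m k i * ?m k j) * v $ j) = e * v $ i" if i: "i < n" for i
  proof -
    have "(?B *\<^sub>v v) $ i = e * v $ i" unfolding Bv using v(1) i by simp
    moreover have "(?B *\<^sub>v v) $ i = (\<Sum>j<n. (\<Sum>k<n. ?m k i * ?m k j) * v $ j)"
      using M v(1) i by (simp add: scalar_prod_def atLeast0LessThan)
    ultimately show ?thesis by simp
  qed
  have "e * of_real ?N = (\<Sum>i<n. e * v $ i * cnj (v $ i))"
    by (simp add: sum_distrib_left complex_norm_square mult.assoc del: of_real_power)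
  also have "\<dots> = (\<Sum>i<n. (\<Sum>j<n. (\<Sum>k<n. ?m k i * ?m k j) * v $ j) * cnj (v $ i))"
    using entry by (intro sum.cong) auto
  also have "\<dots> = (\<Sum>i<n. \<Sum>j<n. \<Sum>k<n. ?m k i * ?m k j * v $ j * cnj (v $ i))"
    by (simp add: sum_distrib_right)
  also have "\<dots> = (\<Sum>i<n. \<Sum>k<n. \<Sum>j<n. ?m k i * ?m k j * v $ j * cnj (v $ i))"
    by (intro sum.cong refl sum.swap)
  also have "\<dots> = (\<Sum>k<n. \<Sum>i<n. \<Sum>j<n. ?m k i * ?m k j * v $ j * cnj (v $ i))"
    by (rule sum.swap)
  also have "\<dots> = (\<Sum>k<n. cnj (?w k) * ?w k)"
    unfolding cnj_sum sum_product by (simp add: mult_ac)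
  also have "\<dots> = of_real (\<Sum>k<n. (cmod (?w k))\<^sup>2)"
    by (simp add: complex_norm_square mult.commute del: cnj_sum of_real_power)
  finally have eN: "e * of_real ?N = of_real (\<Sum>k<n. (cmod (?w k))\<^sup>2)" .
  from v obtain i where "i < n" "v $ i \<noteq> 0" by force
  then have N: "?N > 0" by (intro sum_pos2[of _ i]) auto
  have "e = of_real ((\<Sum>k<n. (cmod (?w k))\<^sup>2) / ?N)"
    using eN N by (simp add: field_simps del: of_real_sum)
  moreover have "0 \<le> (\<Sum>k<n. (cmod (?w k))\<^sup>2) / ?N"
    by (intro divide_nonneg_nonneg sum_nonneg) auto
  ultimately show ?thesis by blast
qed

text \<open>The characteristic polynomial splits over the complex numbers, its roots are real and
  nonnegative by the previous lemma, and the factorization descends because the embedding of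
  coefficients is injective. Diagonalization is avoided: \<open>singular_value\<close> refers only
  to the roots with multiplicity.\<close>

lemma char_poly_gram_split:
  fixes M :: "real mat"
  assumes M: "M \<in> carrier_mat n n"
  shows "\<exists>rs. char_poly (transpose_mat M * M) = (\<Prod>r\<leftarrow>rs. [:- r, 1:]) \<and> length rs = n \<and> (\<forall>r\<in>set rs. 0 \<le> r)"
proof -
  interpret h: map_poly_inj_comm_ring_hom complex_of_real ..
  let ?B = "transpose_mat M * M"
  have B: "?B \<in> carrier_mat n n" using M by auto
  then have Bc: "map_mat complex_of_real ?B \<in> carrier_mat n n" by auto
  obtain es where cp: "char_poly (map_mat complex_of_real ?B) = (\<Prod>a\<leftarrow>es. [:- a, 1:])"
    and len: "length es = n"
    using char_poly_factorized[OF Bc] by blast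
  have real: "\<exists>r\<ge>0. e = complex_of_real r" if "e \<in> set es" for e
  proof (rule gram_eigenvalue_nonneg_real[OF M])
    show "eigenvalue (map_mat complex_of_real ?B) e"
      using eigenvalue_root_char_poly[OF Bc] linear_poly_root[OF that] cp by simp
  qed
  define rs where "rs = map Re es"
  have es: "es = map complex_of_real rs"
  proof -
    have "map (complex_of_real \<circ> Re) es = es" by (rule map_idI) (use real in force)
    then show ?thesis unfolding rs_def by simp
  qed
  have "map_poly complex_of_real (char_poly ?B) = (\<Prod>a\<leftarrow>es. [:- a, 1:])"
    using of_real_hom.char_poly_hom[OF B, where ?'a = complex] cp by simp
  also have "\<dots> = map_poly complex_of_real (\<Prod>r\<leftarrow>rs. [:- r, 1:])"
    unfolding es by (simp add: h.hom_prod_list o_def)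
  finally have "char_poly ?B = (\<Prod>r\<leftarrow>rs. [:- r, 1:])"
    by (simp add: poly_eq_iff coeff_map_poly)
  moreover have "\<forall>r\<in>set rs. 0 \<le> r" unfolding rs_def using real by force
  moreover have "length rs = n" using len unfolding rs_def by simp
  ultimately show ?thesis by blast
qed

section \<open>Traces, roots and symmetric sums of eigenvalues\<close>

lemma trace_mult_commute:
  fixes U V :: "'a::comm_semiring_0 mat"
  assumes "U \<in> carrier_mat n m" "V \<in> carrier_mat m n"
  shows "(\<Sum>i<n. (U * V) $$ (i, i)) = (\<Sum>i<m. (V * U) $$ (i, i))"
proof -
  have "(\<Sum>i<n. (U * V) $$ (i, i)) = (\<Sum>i<n. \<Sum>j<m. U $$ (i, j) * V $$ (j, i))"
    using assms by (simp add: scalar_prod_def atLeast0LessThan)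
  also have "\<dots> = (\<Sum>j<m. \<Sum>i<n. U $$ (i, j) * V $$ (j, i))"
    by (rule sum.swap)
  also have "\<dots> = (\<Sum>i<m. (V * U) $$ (i, i))"
    using assms by (simp add: scalar_prod_def atLeast0LessThan mult.commute)
  finally show ?thesis .
qed

lemma trace_similar:
  fixes A B :: "'a::comm_ring_1 mat"
  assumes "similar_mat_wit A B P Q" "A \<in> carrier_mat n n"
  shows "(\<Sum>i<n. A $$ (i, i)) = (\<Sum>i<n. B $$ (i, i))"
proof -
  note sim = similar_mat_witD2[OF assms(2,1)]
  have "(\<Sum>i<n. A $$ (i, i)) = (\<Sum>i<n. (Q * (P * B)) $$ (i, i))"
    unfolding sim(3) using sim(5-7) by (intro trace_mult_commute) auto
  also have "Q * (P * B) = B"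
    using assoc_mult_mat[OF sim(7,6,5)] sim(2,5) by simp
  finally show ?thesis .
qed

text \<open>By Schur triangularization \<open>A\<close> is similar to an upper triangular matrix
  with diagonal \<open>es\<close>. Traces are invariant under similarity, and squaring a triangular
  matrix squares its diagonal.\<close>

lemma trace_eq_sum_list_eigenvalues:
  fixes A :: "'a::conjugatable_ordered_field mat"
  assumes A: "A \<in> carrier_mat n n" and cp: "char_poly A = (\<Prod>e\<leftarrow>es. [:- e, 1:])"
  shows "(\<Sum>i<n. A $$ (i, i)) = sum_list es"
    and "(\<Sum>i<n. (A * A) $$ (i, i)) = (\<Sum>e\<leftarrow>es. e\<^sup>2)"
proof -
  obtain B P Q where dec: "schur_decomposition A es = (B, P, Q)"
    by (cases "schur_decomposition A es") auto
  from schur_decomposition[OF A cp dec]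
  have sim: "similar_mat_wit A B P Q" and ut: "upper_triangular B" and diag: "diag_mat B = es"
    by auto
  note s = similar_mat_witD2[OF A sim]
  have es: "length es = n" "\<And>i. i < n \<Longrightarrow> es ! i = B $$ (i, i)"
    using s(5) unfolding diag[symmetric] by (auto simp: diag_mat_def)
  show "(\<Sum>i<n. A $$ (i, i)) = sum_list es"
    unfolding trace_similar[OF sim A] by (simp add: sum_list_sum_nth es atLeast0LessThan)
  have "similar_mat_wit (A * A) (B * B) P Q"
    using similar_mat_wit_pow[OF sim, of 2] A s(5) by (simp add: numeral_2_eq_2)
  then have "(\<Sum>i<n. (A * A) $$ (i, i)) = (\<Sum>i<n. (B * B) $$ (i, i))"
    using A by (intro trace_similar) auto
  also have "\<dots> = (\<Sum>i<n. (B $$ (i, i))\<^sup>2)"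
  proof (rule sum.cong[OF refl])
    fix i assume "i \<in> {..<n}"
    then have i: "i < n" by simp
    have "(B * B) $$ (i, i) = (\<Sum>j<n. B $$ (i, j) * B $$ (j, i))"
      using s(5) i by (simp add: scalar_prod_def atLeast0LessThan)
    \<comment> \<open>For \<open>j\<close> different from \<open>i\<close>, one of the two factors
      lies strictly below the diagonal.\<close>
    also have "\<dots> = (\<Sum>j<n. if j = i then (B $$ (i, i))\<^sup>2 else 0)"
    proof (rule sum.cong[OF refl])
      fix j assume "j \<in> {..<n}"
      then show "B $$ (i, j) * B $$ (j, i) = (if j = i then (B $$ (i, i))\<^sup>2 else 0)"
        using ut s(5) i unfolding upper_triangular_def
        by (cases j i rule: linorder_cases) (auto simp: power2_eq_square)
    qed
    finally show "(B * B) $$ (i, i) = (B $$ (i, i))\<^sup>2" using i by simp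
  qed
  finally show "(\<Sum>i<n. (A * A) $$ (i, i)) = (\<Sum>e\<leftarrow>es. e\<^sup>2)"
    by (simp add: sum_list_sum_nth es atLeast0LessThan)
qed

lemma proots_linear_factors: "proots (\<Prod>r\<leftarrow>rs. [:- r, 1:]) = mset (rs :: 'a::idom list)"
proof (induction rs)
  case (Cons r rs)
  have "(\<Prod>r\<leftarrow>rs. [:- r, 1:]) \<noteq> 0" by (auto simp: prod_list_zero_iff)
  then show ?case using Cons by (simp add: proots_mult del: mult_pCons_left)
qed simp

text \<open>After the squares cancel, only products with distinct indices remain. The larger index
  is at least 1, so each product is at most \<open>f 0 * f 1\<close>, and there are fewer than n^2
  of them.\<close>

lemma sorted_sum_products_le:
  fixes f :: "nat \<Rightarrow> real"
  assumes nonneg: "\<And>i. i < n \<Longrightarrow> 0 \<le> f i"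
    and desc: "\<And>i j. i \<le> j \<Longrightarrow> j < n \<Longrightarrow> f j \<le> f i" and n: "2 \<le> n"
  shows "(\<Sum>i<n. f i)\<^sup>2 - (\<Sum>i<n. (f i)\<^sup>2) \<le> (real n)\<^sup>2 * (f 0 * f 1)"
proof -
  have "(\<Sum>i<n. f i)\<^sup>2 - (\<Sum>i<n. (f i)\<^sup>2) = (\<Sum>i<n. (\<Sum>j<n. f i * f j) - (f i)\<^sup>2)"
    by (simp add: power2_eq_square sum_product sum_subtractf)
  also have "\<dots> = (\<Sum>i<n. \<Sum>j<n. if i = j then 0 else f i * f j)"
  proof (rule sum.cong[OF refl])
    fix i assume "i \<in> {..<n}"
    then have "(f i)\<^sup>2 = (\<Sum>j<n. if i = j then f i * f j else 0)"
      by (simp add: power2_eq_square)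
    then show "(\<Sum>j<n. f i * f j) - (f i)\<^sup>2 = (\<Sum>j<n. if i = j then 0 else f i * f j)"
      unfolding \<open>(f i)\<^sup>2 = _\<close> by (subst sum_subtractf[symmetric]) (auto intro!: sum.cong)
  qed
  also have "\<dots> \<le> (\<Sum>i<n. \<Sum>j<n. f 0 * f 1)"
  proof (intro sum_mono)
    fix i j assume "i \<in> {..<n}" "j \<in> {..<n}"
    then have ij: "i < n" "j < n" by auto
    have 01: "0 \<le> f 0" "0 \<le> f 1" using nonneg n by auto
    have le: "f i \<le> f 0" "f j \<le> f 0" using desc ij by auto
    show "(if i = j then 0 else f i * f j) \<le> f 0 * f 1"
    proof (cases i j rule: linorder_cases)
      case less
      then have "f j \<le> f 1" using desc ij by auto
      then show ?thesis using less le 01 nonneg ij by (auto intro: mult_mono)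
    next
      case greater
      then have "f i \<le> f 1" using desc ij by auto
      then have "f j * f i \<le> f 0 * f 1" using le 01 nonneg ij by (auto intro: mult_mono)
      then show ?thesis using greater by (simp add: mult.commute)
    qed (use 01 in auto)
  qed
  also have "\<dots> = (real n)\<^sup>2 * (f 0 * f 1)" by (simp add: power2_eq_square)
  finally show ?thesis .
qed

section \<open>Singular values and 2x2 minors\<close>

text \<open>A Lagrange identity, with right-hand side 2 ((tr B)^2 - tr B^2) for the Gram matrix B of
  \<open>m\<close>. Expanding the square, both pure squares give (tr B)^2 and the mixed term
  regroups into the squared entries of B. Summing over all ordered pairs of rows and of columns
  counts each minor four times but avoids order conditions.\<close>

lemma sum_squared_minors:
  fixes m :: "nat \<Rightarrow> nat \<Rightarrow> real"
  shows "(\<Sum>k<n. \<Sum>l<n. \<Sum>i<n. \<Sum>j<n. (m k i * m l j - m k j * m l i)\<^sup>2)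
    = 2 * ((\<Sum>i<n. \<Sum>k<n. (m k i)\<^sup>2)\<^sup>2 - (\<Sum>i<n. \<Sum>j<n. (\<Sum>k<n. m k i * m k j)\<^sup>2))"
proof -
  let ?S = "\<lambda>f. \<Sum>k<n. \<Sum>l<n. \<Sum>i<n. \<Sum>j<n. f k l i j :: real"
  have ki: "(\<Sum>i<n. \<Sum>k<n. (m k i)\<^sup>2) = (\<Sum>k<n. \<Sum>i<n. (m k i)\<^sup>2)"
    by (rule sum.swap)
  have 1: "?S (\<lambda>k l i j. (m k i * m l j)\<^sup>2) = (\<Sum>i<n. \<Sum>k<n. (m k i)\<^sup>2)\<^sup>2"
    unfolding ki by (simp add: power2_eq_square[of "sum _ _"] sum_product power_mult_distrib)
  have "?S (\<lambda>k l i j. (m k j * m l i)\<^sup>2) = ?S (\<lambda>k l i j. (m k i * m l j)\<^sup>2)"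
    by (rule sum.cong[OF refl], rule sum.cong[OF refl], rule sum.swap)
  note 2 = this[unfolded 1]
  have "(\<Sum>i<n. \<Sum>j<n. (\<Sum>k<n. m k i * m k j)\<^sup>2)
      = (\<Sum>i<n. \<Sum>j<n. \<Sum>k<n. \<Sum>l<n. m k i * m l j * (m k j * m l i))"
    by (simp add: power2_eq_square sum_product mult_ac)
  also have "\<dots> = (\<Sum>i<n. \<Sum>k<n. \<Sum>j<n. \<Sum>l<n. m k i * m l j * (m k j * m l i))"
    by (rule sum.cong[OF refl], rule sum.swap)
  also have "\<dots> = (\<Sum>k<n. \<Sum>i<n. \<Sum>j<n. \<Sum>l<n. m k i * m l j * (m k j * m l i))"
    by (rule sum.swap)
  also have "\<dots> = (\<Sum>k<n. \<Sum>i<n. \<Sum>l<n. \<Sum>j<n. m k i * m l j * (m k j * m l i))"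
    by (rule sum.cong[OF refl], rule sum.cong[OF refl], rule sum.swap)
  also have "\<dots> = ?S (\<lambda>k l i j. m k i * m l j * (m k j * m l i))"
    by (rule sum.cong[OF refl], rule sum.swap)
  finally have 3: "?S (\<lambda>k l i j. m k i * m l j * (m k j * m l i))
      = (\<Sum>i<n. \<Sum>j<n. (\<Sum>k<n. m k i * m k j)\<^sup>2)" by simp
  have "?S (\<lambda>k l i j. (m k i * m l j - m k j * m l i)\<^sup>2)
      = ?S (\<lambda>k l i j. (m k i * m l j)\<^sup>2) + ?S (\<lambda>k l i j. (m k j * m l i)\<^sup>2)
        - 2 * ?S (\<lambda>k l i j. m k i * m l j * (m k j * m l i))"
    by (simp add: power2_diff sum.distrib sum_subtractf sum_distrib_left mult.assoc)
  then show ?thesis unfolding 1 2 3 by simp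
qed

text \<open>The two traces are the sums of the second and fourth powers of the singular values, so
  the difference in the second claim consists of products of two squared singular values with
  distinct indices.\<close>

lemma singular_values_gram:
  assumes M: "M \<in> carrier_mat n n" and n: "2 \<le> n"
  defines "B \<equiv> transpose_mat M * M"
  shows "(singular_value 1 M)\<^sup>2 \<le> (\<Sum>i<n. B $$ (i, i))"
    and "(\<Sum>i<n. B $$ (i, i))\<^sup>2 - (\<Sum>i<n. (B * B) $$ (i, i))
      \<le> (real n)\<^sup>2 * (singular_value 1 M * singular_value 2 M)\<^sup>2"
proof -
  have B: "B \<in> carrier_mat n n" using M unfolding B_def by auto
  obtain rs where cp: "char_poly B = (\<Prod>r\<leftarrow>rs. [:- r, 1:])" and len: "length rs = n"
    and nonneg: "\<And>r. r \<in> set rs \<Longrightarrow> 0 \<le> r"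
    using char_poly_gram_split[OF M] unfolding B_def by blast
  define xs where "xs = rev (sort (map sqrt rs))"
  have sv: "singular_value k M = xs ! (k - 1)" for k
    unfolding singular_value_def B_def[symmetric] cp proots_linear_factors xs_def
    by (simp flip: mset_map)
  have lx: "length xs = n" unfolding xs_def using len by simp
  have pos: "0 \<le> xs ! i" if "i < n" for i
    using nth_mem[of i xs] that lx nonneg unfolding xs_def by auto
  have desc: "xs ! j \<le> xs ! i" if "i \<le> j" "j < n" for i j
    using sorted_rev_nth_mono[of xs i j] that lx unfolding xs_def by simp
  \<comment> \<open>\<open>xs\<close> is a rearrangement of the square roots of \<open>rs\<close>,
    and squaring recovers \<open>rs\<close> because its members are nonnegative. Taking
    \<open>h\<close> to be the identity or the square yields the two traces.\<close>
  have sum: "(\<Sum>r\<leftarrow>rs. h r) = (\<Sum>i<n. h ((xs ! i)\<^sup>2))" for h :: "real \<Rightarrow> real"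
  proof -
    have "(\<Sum>i<n. h ((xs ! i)\<^sup>2)) = (\<Sum>x\<leftarrow>xs. h (x\<^sup>2))"
      by (simp add: sum_list_sum_nth lx atLeast0LessThan)
    also have "\<dots> = (\<Sum>x\<in>#mset xs. h (x\<^sup>2))" by (metis mset_map sum_mset_sum_list)
    also have "\<dots> = (\<Sum>x\<leftarrow>map sqrt rs. h (x\<^sup>2))"
      unfolding xs_def by (metis mset_map mset_rev mset_sort sum_mset_sum_list)
    also have "\<dots> = (\<Sum>r\<leftarrow>rs. h r)"
      using nonneg by (auto simp: o_def intro!: arg_cong[where f = sum_list])
    finally show ?thesis by simp
  qed
  note tr = trace_eq_sum_list_eigenvalues[OF B cp]
  have tr1: "(\<Sum>i<n. B $$ (i, i)) = (\<Sum>i<n. (xs ! i)\<^sup>2)"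
    using tr(1) sum[of "\<lambda>r. r"] by simp
  have tr2: "(\<Sum>i<n. (B * B) $$ (i, i)) = (\<Sum>i<n. ((xs ! i)\<^sup>2)\<^sup>2)"
    using tr(2) sum[of "\<lambda>r. r\<^sup>2"] by simp
  show "(singular_value 1 M)\<^sup>2 \<le> (\<Sum>i<n. B $$ (i, i))"
    unfolding sv tr1 using n by (auto intro!: member_le_sum[of 0])
  have "(\<Sum>i<n. (xs ! i)\<^sup>2)\<^sup>2 - (\<Sum>i<n. ((xs ! i)\<^sup>2)\<^sup>2) \<le> (real n)\<^sup>2 * ((xs ! 0)\<^sup>2 * (xs ! 1)\<^sup>2)"
    using n pos desc by (intro sorted_sum_products_le power_mono) auto
  then show "(\<Sum>i<n. B $$ (i, i))\<^sup>2 - (\<Sum>i<n. (B * B) $$ (i, i))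
      \<le> (real n)\<^sup>2 * (singular_value 1 M * singular_value 2 M)\<^sup>2"
    unfolding sv tr1 tr2 by (simp add: power_mult_distrib)
qed

text \<open>The first bound turns upper bounds on the entries into one on \<sigma>1; the second
  turns lower bounds on minors into one on \<sigma>1 \<sigma>2.\<close>

lemma singular_values_minors:
  assumes M: "M \<in> carrier_mat n n" and n: "2 \<le> n"
  shows "(singular_value 1 M)\<^sup>2 \<le> (\<Sum>i<n. \<Sum>k<n. (M $$ (k, i))\<^sup>2)"
    and "(\<Sum>k<n. \<Sum>l<n. \<Sum>i<n. \<Sum>j<n. (M $$ (k, i) * M $$ (l, j) - M $$ (k, j) * M $$ (l, i))\<^sup>2)
      \<le> 2 * (real n)\<^sup>2 * (singular_value 1 M * singular_value 2 M)\<^sup>2"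
proof -
  let ?B = "transpose_mat M * M"
  have B: "?B $$ (i, j) = (\<Sum>k<n. M $$ (k, i) * M $$ (k, j))" if "i < n" "j < n" for i j
    using M that by (simp add: scalar_prod_def atLeast0LessThan)
  have tr1: "(\<Sum>i<n. ?B $$ (i, i)) = (\<Sum>i<n. \<Sum>k<n. (M $$ (k, i))\<^sup>2)"
    using B by (simp add: power2_eq_square)
  have tr2: "(\<Sum>i<n. (?B * ?B) $$ (i, i)) = (\<Sum>i<n. \<Sum>j<n. (\<Sum>k<n. M $$ (k, i) * M $$ (k, j))\<^sup>2)"
  proof (rule sum.cong[OF refl])
    fix i assume "i \<in> {..<n}"
    then have i: "i < n" by simp
    have "(?B * ?B) $$ (i, i) = (\<Sum>j<n. ?B $$ (i, j) * ?B $$ (j, i))"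
      using M i by (subst index_mult_mat) (auto simp: scalar_prod_def atLeast0LessThan)
    also have "\<dots> = (\<Sum>j<n. (\<Sum>k<n. M $$ (k, i) * M $$ (k, j))\<^sup>2)"
      using B i by (intro sum.cong) (auto simp: power2_eq_square mult.commute)
    finally show "(?B * ?B) $$ (i, i) = (\<Sum>j<n. (\<Sum>k<n. M $$ (k, i) * M $$ (k, j))\<^sup>2)" .
  qed
  note sv = singular_values_gram[OF M n, unfolded tr1 tr2]
  show "(singular_value 1 M)\<^sup>2 \<le> (\<Sum>i<n. \<Sum>k<n. (M $$ (k, i))\<^sup>2)" by (rule sv(1))
  show "(\<Sum>k<n. \<Sum>l<n. \<Sum>i<n. \<Sum>j<n. (M $$ (k, i) * M $$ (l, j) - M $$ (k, j) * M $$ (l, i))\<^sup>2)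
      \<le> 2 * (real n)\<^sup>2 * (singular_value 1 M * singular_value 2 M)\<^sup>2"
    unfolding sum_squared_minors using sv(2) by (simp add: mult.assoc)
qed

section \<open>Growth of matrix powers\<close>

text \<open>The left side is a squared coordinate of the wedge of \<open>M v\<close> and
  \<open>M w\<close>, a combination of minors of the rows \<open>k\<close> and \<open>l\<close> with
  coefficients \<open>v i * w j\<close>. The factor \<open>?K\<close> depends on \<open>v\<close>
  and \<open>w\<close> only, so the estimate is uniform over all powers of a matrix.\<close>

lemma wedge_le_minors:
  fixes m :: "nat \<Rightarrow> nat \<Rightarrow> real" and v w :: "nat \<Rightarrow> complex"
  assumes kl: "k < n" "l < n"
  defines "mv \<equiv> \<lambda>k. \<Sum>i<n. of_real (m k i) * v i" and "mw \<equiv> \<lambda>k. \<Sum>i<n. of_real (m k i) * w i"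
  shows "(cmod (mv k * mw l - mv l * mw k))\<^sup>2
    \<le> (\<Sum>i<n. \<Sum>j<n. cmod (v i) * cmod (w j))\<^sup>2
      * (\<Sum>k<n. \<Sum>l<n. \<Sum>i<n. \<Sum>j<n. (m k i * m l j - m k j * m l i)\<^sup>2)" (is "_ \<le> ?K\<^sup>2 * ?D")
proof -
  let ?\<mu> = "\<lambda>i j. m k i * m l j - m k j * m l i"
  have D: "(?\<mu> i j)\<^sup>2 \<le> ?D" if "i < n" "j < n" for i j
  proof -
    have "(?\<mu> i j)\<^sup>2 \<le> (\<Sum>j<n. (?\<mu> i j)\<^sup>2)"
      using that by (intro member_le_sum) auto
    also have "\<dots> \<le> (\<Sum>i<n. \<Sum>j<n. (?\<mu> i j)\<^sup>2)"
      using that by (intro member_le_sum[where f = "\<lambda>i. \<Sum>j<n. (?\<mu> i j)\<^sup>2"]) (auto intro: sum_nonneg)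
    also have "\<dots> \<le> (\<Sum>l<n. \<Sum>i<n. \<Sum>j<n. (m k i * m l j - m k j * m l i)\<^sup>2)"
      using kl by (intro member_le_sum[where f = "\<lambda>l. \<Sum>i<n. \<Sum>j<n. (m k i * m l j - m k j * m l i)\<^sup>2"])
        (auto intro!: sum_nonneg)
    also have "\<dots> \<le> ?D"
      using kl by (intro member_le_sum[where f = "\<lambda>k. \<Sum>l<n. \<Sum>i<n. \<Sum>j<n. (m k i * m l j - m k j * m l i)\<^sup>2"])
        (auto intro!: sum_nonneg)
    finally show ?thesis .
  qed
  have "mv k * mw l - mv l * mw k = (\<Sum>i<n. \<Sum>j<n. of_real (?\<mu> i j) * (v i * w j))"
    unfolding mv_def mw_def sum_product sum_subtractf[symmetric]
    by (intro sum.cong refl) (simp add: algebra_simps)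
  then have "cmod (mv k * mw l - mv l * mw k) \<le> (\<Sum>i<n. \<Sum>j<n. cmod (of_real (?\<mu> i j) * (v i * w j)))"
    by (auto intro!: order_trans[OF norm_sum] sum_mono)
  also have "\<dots> \<le> (\<Sum>i<n. \<Sum>j<n. sqrt ?D * (cmod (v i) * cmod (w j)))"
    unfolding norm_mult norm_of_real
    by (intro sum_mono mult_right_mono real_le_rsqrt) (use D in auto)
  also have "\<dots> = sqrt ?D * ?K" by (simp only: sum_distrib_left)
  finally have "(cmod (mv k * mw l - mv l * mw k))\<^sup>2 \<le> (sqrt ?D * ?K)\<^sup>2"
    by (intro power_mono) auto
  also have "\<dots> = ?K\<^sup>2 * ?D"
    by (simp add: power_mult_distrib sum_nonneg)
  finally show ?thesis .
qed

text \<open>The vectors are the first two columns of \<open>P\<close> in \<open>A P = P B\<close>,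
  where the Schur form \<open>B\<close> has its diagonal in the prescribed order. The coefficient
  \<open>a\<close> is the entry of \<open>B\<close> above \<mu>; it covers the case of a Jordan
  block, where \<open>w\<close> cannot be an eigenvector. The nonzero minor expresses linear
  independence.\<close>

lemma invariant_plane:
  fixes A :: "complex mat"
  assumes A: "A \<in> carrier_mat n n" and cp: "char_poly A = (\<Prod>e\<leftarrow>\<alpha> # \<mu> # es. [:- e, 1:])"
  obtains v w a k l where "v \<in> carrier_vec n" "w \<in> carrier_vec n" "A *\<^sub>v v = \<alpha> \<cdot>\<^sub>v v"
    "A *\<^sub>v w = a \<cdot>\<^sub>v v + \<mu> \<cdot>\<^sub>v w" "k < n" "l < n" "v $ k * w $ l - v $ l * w $ k \<noteq> 0"
proof -
  obtain B P Q where dec: "schur_decomposition A (\<alpha> # \<mu> # es) = (B, P, Q)"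
    by (cases "schur_decomposition A (\<alpha> # \<mu> # es)") auto
  from schur_decomposition[OF A cp dec]
  have sim: "similar_mat_wit A B P Q" and ut: "upper_triangular B" and diag: "diag_mat B = \<alpha> # \<mu> # es"
    by auto
  note s = similar_mat_witD2[OF A sim]
  have "length (diag_mat B) = n" using s(5) by (simp add: diag_mat_def)
  then have n: "0 < n" "1 < n" unfolding diag by auto
  have B0: "B $$ (0, 0) = \<alpha>" and B1: "B $$ (1, 1) = \<mu>"
    using arg_cong[OF diag, of "\<lambda>xs. xs ! 0"] arg_cong[OF diag, of "\<lambda>xs. xs ! 1"] n s(5)
    by (simp_all add: diag_mat_def)
  have AP: "A * P = P * B"
  proof -
    have "A * P = P * B * (Q * P)"
      using assoc_mult_mat[OF mult_carrier_mat[OF s(6,5)] s(7,6)] s(3) by simp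
    then show ?thesis using s(2,5,6) by simp
  qed
  let ?v = "col P 0" and ?w = "col P 1"
  have colAP: "A *\<^sub>v col P j = vec n (\<lambda>i. \<Sum>k<n. P $$ (i, k) * B $$ (k, j))" if "j < n" for j
  proof -
    have "A *\<^sub>v col P j = col (P * B) j" unfolding AP[symmetric] using col_mult2[OF A s(6) that] by simp
    also have "\<dots> = vec n (\<lambda>i. \<Sum>k<n. P $$ (i, k) * B $$ (k, j))"
      using that s by (intro eq_vecI) (auto simp: scalar_prod_def atLeast0LessThan)
    finally show ?thesis .
  qed
  have low: "B $$ (k, j) = 0" if "j < k" "k < n" for j k
    using ut s(5) that unfolding upper_triangular_def by auto
  have Av: "A *\<^sub>v ?v = \<alpha> \<cdot>\<^sub>v ?v"
  proof (rule eq_vecI)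
    fix i assume "i < dim_vec (\<alpha> \<cdot>\<^sub>v ?v)"
    then have i: "i < n" using s by simp
    have "(\<Sum>k<n. P $$ (i, k) * B $$ (k, 0)) = (\<Sum>k\<in>{0}. P $$ (i, k) * B $$ (k, 0))"
      using n low by (intro sum.mono_neutral_right) auto
    then show "(A *\<^sub>v ?v) $ i = (\<alpha> \<cdot>\<^sub>v ?v) $ i"
      using colAP[OF n(1)] i s n B0 by simp
  qed (use s in simp)
  have Aw: "A *\<^sub>v ?w = B $$ (0, 1) \<cdot>\<^sub>v ?v + \<mu> \<cdot>\<^sub>v ?w"
  proof (rule eq_vecI)
    fix i assume "i < dim_vec (B $$ (0, 1) \<cdot>\<^sub>v ?v + \<mu> \<cdot>\<^sub>v ?w)"
    then have i: "i < n" using s by simp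
    have "(\<Sum>k<n. P $$ (i, k) * B $$ (k, 1)) = (\<Sum>k\<in>{0, 1}. P $$ (i, k) * B $$ (k, 1))"
      using n low by (intro sum.mono_neutral_right) auto
    then show "(A *\<^sub>v ?w) $ i = (B $$ (0, 1) \<cdot>\<^sub>v ?v + \<mu> \<cdot>\<^sub>v ?w) $ i"
      using colAP[OF n(2)] i s n B1 by simp
  qed (use s in simp)
  have QP: "(\<Sum>k<n. Q $$ (i, k) * P $$ (k, j)) = (if i = j then 1 else 0)" if "i < n" "j < n" for i j
  proof -
    have "(Q * P) $$ (i, j) = (if i = j then 1 else 0)" using s(2) that by simp
    then show ?thesis using that s(6,7) by (simp add: scalar_prod_def atLeast0LessThan)
  qed
  have "\<exists>k<n. \<exists>l<n. ?v $ k * ?w $ l - ?v $ l * ?w $ k \<noteq> 0"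
  proof (rule ccontr)
    assume "\<not> ?thesis"
    then have z: "P $$ (k, 0) * P $$ (l, 1) - P $$ (l, 0) * P $$ (k, 1) = 0" if "k < n" "l < n" for k l
      using that s n by auto
    \<comment> \<open>This is the leading 2x2 minor of \<open>Q * P = 1\<close>, which Cauchy-Binet
      expands in minors of the two columns of \<open>P\<close>.\<close>
    have "1 = (\<Sum>k<n. Q $$ (0, k) * P $$ (k, 0)) * (\<Sum>l<n. Q $$ (1, l) * P $$ (l, 1))
        - (\<Sum>k<n. Q $$ (0, k) * P $$ (k, 1)) * (\<Sum>l<n. Q $$ (1, l) * P $$ (l, 0))"
      using QP n by simp
    also have "\<dots> = (\<Sum>k<n. \<Sum>l<n. Q $$ (0, k) * Q $$ (1, l)
        * (P $$ (k, 0) * P $$ (l, 1) - P $$ (l, 0) * P $$ (k, 1)))"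
      unfolding sum_product sum_subtractf[symmetric]
      by (intro sum.cong refl) (simp add: algebra_simps)
    also have "\<dots> = 0" using z by simp
    finally show False by simp
  qed
  then obtain k l where "k < n" "l < n" "?v $ k * ?w $ l - ?v $ l * ?w $ k \<noteq> 0" by blast
  then show thesis using that[OF _ _ Av Aw] s by auto
qed

text \<open>Powers stay triangular on the plane. The off-diagonal coefficient is left unspecified,
  since it cancels in the exterior square.\<close>

lemma pow_mat_invariant_plane:
  fixes A :: "'a::field mat"
  assumes A: "A \<in> carrier_mat n n" and v: "v \<in> carrier_vec n" and w: "w \<in> carrier_vec n"
    and Av: "A *\<^sub>v v = \<alpha> \<cdot>\<^sub>v v" and Aw: "A *\<^sub>v w = a \<cdot>\<^sub>v v + \<mu> \<cdot>\<^sub>v w"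
  shows "A ^\<^sub>m N *\<^sub>v v = \<alpha> ^ N \<cdot>\<^sub>v v" and "\<exists>b. A ^\<^sub>m N *\<^sub>v w = b \<cdot>\<^sub>v v + \<mu> ^ N \<cdot>\<^sub>v w"
proof -
  have AN: "A ^\<^sub>m N \<in> carrier_mat n n" for N using A by simp
  have pv: "A ^\<^sub>m N *\<^sub>v v = \<alpha> ^ N \<cdot>\<^sub>v v" for N
  proof (induction N)
    case (Suc N)
    have "A ^\<^sub>m Suc N *\<^sub>v v = A ^\<^sub>m N *\<^sub>v (\<alpha> \<cdot>\<^sub>v v)"
      using assoc_mult_mat_vec[OF AN A v] Av by simp
    also have "\<dots> = \<alpha> ^ Suc N \<cdot>\<^sub>v v"
      using mult_mat_vec[OF AN v] Suc by (simp add: smult_smult_assoc)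
    finally show ?case .
  qed (use A v in auto)
  then show "A ^\<^sub>m N *\<^sub>v v = \<alpha> ^ N \<cdot>\<^sub>v v" .
  show "\<exists>b. A ^\<^sub>m N *\<^sub>v w = b \<cdot>\<^sub>v v + \<mu> ^ N \<cdot>\<^sub>v w"
  proof (induction N)
    case 0
    show ?case using A v w by (intro exI[of _ 0]) auto
  next
    case (Suc N)
    then obtain b where b: "A ^\<^sub>m N *\<^sub>v w = b \<cdot>\<^sub>v v + \<mu> ^ N \<cdot>\<^sub>v w" by blast
    have "A ^\<^sub>m Suc N *\<^sub>v w = A ^\<^sub>m N *\<^sub>v (a \<cdot>\<^sub>v v + \<mu> \<cdot>\<^sub>v w)"
      using assoc_mult_mat_vec[OF AN A w] Aw by simp
    also have "\<dots> = a \<cdot>\<^sub>v (A ^\<^sub>m N *\<^sub>v v) + \<mu> \<cdot>\<^sub>v (A ^\<^sub>m N *\<^sub>v w)"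
      using v w AN by (simp add: mult_add_distrib_mat_vec[of _ n n] mult_mat_vec[of _ n n])
    also have "\<dots> = (a * \<alpha> ^ N + \<mu> * b) \<cdot>\<^sub>v v + \<mu> ^ Suc N \<cdot>\<^sub>v w"
      unfolding pv b using v w by (intro eq_vecI) (auto simp: algebra_simps)
    finally show ?case by blast
  qed
qed

lemma smult_pow_mat:
  fixes A :: "'a::comm_ring_1 mat"
  assumes A: "A \<in> carrier_mat n n"
  shows "(c \<cdot>\<^sub>m A) ^\<^sub>m k = c ^ k \<cdot>\<^sub>m (A ^\<^sub>m k)"
proof (induction k)
  case (Suc k)
  have Ak: "A ^\<^sub>m k \<in> carrier_mat n n" using A by simp
  have "(c \<cdot>\<^sub>m A) ^\<^sub>m Suc k = c ^ k \<cdot>\<^sub>m (A ^\<^sub>m k) * (c \<cdot>\<^sub>m A)" using Suc by simp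
  also have "\<dots> = c ^ Suc k \<cdot>\<^sub>m (A ^\<^sub>m Suc k)"
    using A Ak mult_smult_distrib[of "c ^ k \<cdot>\<^sub>m (A ^\<^sub>m k)" n n A n c] mult_smult_assoc_mat[OF Ak A]
    by (auto intro!: eq_matI)
  finally show ?case .
qed (use A in \<open>auto intro: eq_matI\<close>)

text \<open>Division by \<open>r\<close> brings the spectral radius down to at most 1, where the
  Jordan normal form bounds powers by a polynomial. For \<open>0 < k\<close> the power
  \<open>k ^ p\<close> is at least 1 and absorbs the constant term.\<close>

lemma pow_mat_growth:
  fixes A :: "complex mat"
  assumes A: "A \<in> carrier_mat n n" and n: "0 < n" and r: "0 < r"
    and le: "\<And>e. eigenvalue A e \<Longrightarrow> cmod e \<le> r"
  obtains K p where "0 < K"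
    "\<And>k i j. 0 < k \<Longrightarrow> i < n \<Longrightarrow> j < n \<Longrightarrow> cmod ((A ^\<^sub>m k) $$ (i, j)) \<le> r ^ k * (K * real k ^ p)"
proof -
  define B where "B = complex_of_real (1 / r) \<cdot>\<^sub>m A"
  have B: "B \<in> carrier_mat n n" using A unfolding B_def by simp
  have "cmod e \<le> 1" if "eigenvalue B e" for e
  proof -
    from that obtain v where v: "v \<in> carrier_vec n" "v \<noteq> 0\<^sub>v n" "B *\<^sub>v v = e \<cdot>\<^sub>v v"
      using B unfolding eigenvalue_def eigenvector_def by auto
    have "A *\<^sub>v v = complex_of_real r \<cdot>\<^sub>v (B *\<^sub>v v)"
      using A v(1) r unfolding B_def by (intro eq_vecI) (auto simp: scalar_prod_def sum_distrib_left mult.assoc)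
    then have "eigenvalue A (complex_of_real r * e)"
      using v A unfolding eigenvalue_def eigenvector_def by (auto simp: smult_smult_assoc)
    from le[OF this] show ?thesis using r by (simp add: norm_mult)
  qed
  then have "spectral_radius B \<le> 1"
    using spectral_radius_mem_max(1)[OF B n] unfolding spectrum_def by auto
  from spectral_radius_jnf_norm_bound_le_1_upper_triangular[OF B this]
  obtain c1 c2 where nb: "\<And>k. norm_bound (B ^\<^sub>m k) (c1 + c2 * real k ^ (n - 1))" by auto
  show thesis
  proof
    \<comment> \<open>The signs of \<open>c1\<close> and \<open>c2\<close> are unknown, hence the
      absolute values; the summand 1 makes the constant positive.\<close>
    show "0 < \<bar>c1\<bar> + \<bar>c2\<bar> + 1" by linarith
    fix k i j :: nat assume k: "0 < k" and ij: "i < n" "j < n"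
    have dims: "dim_row (A ^\<^sub>m k) = n" "dim_col (A ^\<^sub>m k) = n" using A by auto
    have k1: "1 \<le> real k ^ (n - 1)" using k by (simp add: one_le_power)
    have "cmod ((A ^\<^sub>m k) $$ (i, j)) = r ^ k * cmod ((B ^\<^sub>m k) $$ (i, j))"
      unfolding B_def smult_pow_mat[OF A] using dims ij r
      by (simp add: norm_mult norm_power norm_divide power_divide)
    also have "\<dots> \<le> r ^ k * (c1 + c2 * real k ^ (n - 1))"
      using nb[of k] ij r B unfolding norm_bound_def by (intro mult_left_mono) auto
    also have "\<dots> \<le> r ^ k * ((\<bar>c1\<bar> + \<bar>c2\<bar> + 1) * real k ^ (n - 1))"
    proof (intro mult_left_mono)
      have "c1 \<le> \<bar>c1\<bar> * real k ^ (n - 1)"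
        using mult_left_mono[OF k1, of "\<bar>c1\<bar>"] by linarith
      moreover have "c2 * real k ^ (n - 1) \<le> (\<bar>c2\<bar> + 1) * real k ^ (n - 1)"
        using k1 by (intro mult_right_mono) auto
      ultimately show "c1 + c2 * real k ^ (n - 1) \<le> (\<bar>c1\<bar> + \<bar>c2\<bar> + 1) * real k ^ (n - 1)"
        by (simp add: algebra_simps)
    qed (use r in simp)
    finally show "cmod ((A ^\<^sub>m k) $$ (i, j)) \<le> r ^ k * ((\<bar>c1\<bar> + \<bar>c2\<bar> + 1) * real k ^ (n - 1))" .
  qed
qed

text \<open>On the exterior square of the invariant plane, \<open>A ^\<^sub>m N\<close> is
  multiplication by (\<alpha> \<mu>)^N. One nonzero coordinate of the wedge of \<open>v\<close> and
  \<open>w\<close> therefore forces the minors to be large.\<close>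

lemma sum_squared_minors_pow_ge:
  fixes A :: "real mat"
  assumes A: "A \<in> carrier_mat n n"
    and cp: "char_poly (map_mat complex_of_real A) = (\<Prod>e\<leftarrow>\<alpha> # \<mu> # es. [:- e, 1:])"
  obtains \<delta> where "0 < \<delta>" "\<And>N. \<delta> * (cmod \<alpha> * cmod \<mu>) ^ (2 * N) \<le> (\<Sum>k<n. \<Sum>l<n. \<Sum>i<n. \<Sum>j<n.
      ((A ^\<^sub>m N) $$ (k, i) * (A ^\<^sub>m N) $$ (l, j) - (A ^\<^sub>m N) $$ (k, j) * (A ^\<^sub>m N) $$ (l, i))\<^sup>2)"
proof -
  let ?A = "map_mat complex_of_real A"
  have Ac: "?A \<in> carrier_mat n n" using A by simp
  obtain v w a k l where v: "v \<in> carrier_vec n" and w: "w \<in> carrier_vec n"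
    and Av: "?A *\<^sub>v v = \<alpha> \<cdot>\<^sub>v v" and Aw: "?A *\<^sub>v w = a \<cdot>\<^sub>v v + \<mu> \<cdot>\<^sub>v w"
    and kl: "k < n" "l < n" and nz: "v $ k * w $ l - v $ l * w $ k \<noteq> 0"
    using invariant_plane[OF Ac cp] by blast
  let ?K = "\<Sum>i<n. \<Sum>j<n. cmod (v $ i) * cmod (w $ j)"
  let ?z = "v $ k * w $ l - v $ l * w $ k"
  have bound: "(cmod ?z)\<^sup>2 * (cmod \<alpha> * cmod \<mu>) ^ (2 * N) \<le> ?K\<^sup>2 * (\<Sum>k<n. \<Sum>l<n. \<Sum>i<n. \<Sum>j<n.
      ((A ^\<^sub>m N) $$ (k, i) * (A ^\<^sub>m N) $$ (l, j) - (A ^\<^sub>m N) $$ (k, j) * (A ^\<^sub>m N) $$ (l, i))\<^sup>2)" for N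
  proof -
    let ?M = "A ^\<^sub>m N"
    obtain b where b: "?A ^\<^sub>m N *\<^sub>v w = b \<cdot>\<^sub>v v + \<mu> ^ N \<cdot>\<^sub>v w"
      using pow_mat_invariant_plane(2)[OF Ac v w Av Aw] by blast
    note a = pow_mat_invariant_plane(1)[OF Ac v w Av Aw, of N]
    have M: "?M \<in> carrier_mat n n" using A by simp
    have pow: "?A ^\<^sub>m N = map_mat complex_of_real ?M"
      by (rule of_real_hom.mat_hom_pow[OF A, symmetric])
    have apply_M: "(\<Sum>i<n. complex_of_real (?M $$ (k, i)) * u $ i) = (?A ^\<^sub>m N *\<^sub>v u) $ k"
      if "k < n" "u \<in> carrier_vec n" for k u
      unfolding pow using A M that by (simp add: scalar_prod_def atLeast0LessThan)
    have Mv: "(\<Sum>i<n. complex_of_real (?M $$ (k, i)) * v $ i) = \<alpha> ^ N * v $ k" if "k < n" for k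
      unfolding apply_M[OF that v] a using that v by simp
    have Mw: "(\<Sum>i<n. complex_of_real (?M $$ (k, i)) * w $ i) = b * v $ k + \<mu> ^ N * w $ k" if "k < n" for k
      unfolding apply_M[OF that w] b using that v w by simp
    \<comment> \<open>The terms with \<open>b\<close> form a multiple of the wedge of
      \<open>v\<close> with itself and cancel.\<close>
    have eq: "\<alpha> ^ N * v $ k * (b * v $ l + \<mu> ^ N * w $ l) - \<alpha> ^ N * v $ l * (b * v $ k + \<mu> ^ N * w $ k)
        = \<alpha> ^ N * \<mu> ^ N * ?z"
      by (simp add: algebra_simps)
    from wedge_le_minors[OF kl, of "\<lambda>k i. ?M $$ (k, i)" "\<lambda>i. v $ i" "\<lambda>i. w $ i"]
    have "(cmod (\<alpha> ^ N * \<mu> ^ N * ?z))\<^sup>2 \<le> ?K\<^sup>2 * (\<Sum>k<n. \<Sum>l<n. \<Sum>i<n. \<Sum>j<n.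
        (?M $$ (k, i) * ?M $$ (l, j) - ?M $$ (k, j) * ?M $$ (l, i))\<^sup>2)"
      unfolding Mv[OF kl(1)] Mv[OF kl(2)] Mw[OF kl(1)] Mw[OF kl(2)] eq .
    moreover have "(cmod (\<alpha> ^ N * \<mu> ^ N * ?z))\<^sup>2 = (cmod ?z)\<^sup>2 * (cmod \<alpha> * cmod \<mu>) ^ (2 * N)"
      by (simp only: norm_mult norm_power power_mult_distrib power_mult power_commutes
          flip: power_mult) (simp add: mult.commute)
    ultimately show ?thesis by simp
  qed
  \<comment> \<open>Already the bound for exponent 0 fails if \<open>?K\<close> vanishes, as
    \<open>?z\<close> is nonzero.\<close>
  have "?K \<noteq> 0"
  proof
    assume "?K = 0"
    with bound[of 0] have "(cmod ?z)\<^sup>2 \<le> 0" by simp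
    then show False using nz by simp
  qed
  then have K: "0 < ?K\<^sup>2" by simp
  show thesis
  proof
    show "0 < (cmod ?z)\<^sup>2 / ?K\<^sup>2" using nz K by simp
    fix N
    show "(cmod ?z)\<^sup>2 / ?K\<^sup>2 * (cmod \<alpha> * cmod \<mu>) ^ (2 * N) \<le> (\<Sum>k<n. \<Sum>l<n. \<Sum>i<n. \<Sum>j<n.
      ((A ^\<^sub>m N) $$ (k, i) * (A ^\<^sub>m N) $$ (l, j) - (A ^\<^sub>m N) $$ (k, j) * (A ^\<^sub>m N) $$ (l, i))\<^sup>2)"
      using bound[of N] K by (simp add: divide_le_eq mult.commute)
  qed
qed

text \<open>Take \<alpha> of maximal modulus. Either it is a multiple root and \<mu> = \<alpha>, or
  it is simple and the failure of proximality supplies another eigenvalue of the same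
  modulus.\<close>

lemma not_proximal_cases:
  fixes A :: "real mat"
  assumes A: "A \<in> carrier_mat n n" and n: "0 < n" and np: "\<not> proximal A"
  obtains \<alpha> \<mu> es where "char_poly (map_mat complex_of_real A) = (\<Prod>e\<leftarrow>\<alpha> # \<mu> # es. [:- e, 1:])"
    "cmod \<mu> = cmod \<alpha>" "eigenvalue (map_mat complex_of_real A) \<alpha>"
    "\<And>e. eigenvalue (map_mat complex_of_real A) e \<Longrightarrow> cmod e \<le> cmod \<alpha>"
proof -
  let ?A = "map_mat complex_of_real A"
  have Ac: "?A \<in> carrier_mat n n" using A by simp
  obtain as where cp: "char_poly ?A = (\<Prod>a\<leftarrow>as. [:- a, 1:])" and len: "length as = n"
    using char_poly_factorized[OF Ac] by blast
  have ev: "eigenvalue ?A e \<longleftrightarrow> e \<in> set as" for e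
    unfolding eigenvalue_root_char_poly[OF Ac] cp
    by (auto simp: poly_prod_list o_def prod_list_zero_iff)
  have ord: "Polynomial.order e (char_poly ?A) = count (mset as) e" for e
  proof -
    have "char_poly ?A \<noteq> 0" unfolding cp by (auto simp: prod_list_zero_iff)
    then show ?thesis using count_proots[of "char_poly ?A" e] cp proots_linear_factors[of as] by simp
  qed
  have "Max (cmod ` set as) \<in> cmod ` set as" using len n by (intro Max_in) auto
  then obtain \<alpha> where \<alpha>: "\<alpha> \<in> set as" "cmod \<alpha> = Max (cmod ` set as)" by auto
  have max: "cmod e \<le> cmod \<alpha>" if "e \<in> set as" for e
    unfolding \<alpha>(2) using that by (intro Max_ge) auto
  \<comment> \<open>\<open>remove1\<close> deletes a single copy of \<alpha>, so both cases amount
    to a second entry of the same modulus.\<close>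
  have "\<exists>\<mu>\<in>set (remove1 \<alpha> as). cmod \<mu> = cmod \<alpha>"
  proof (cases "\<alpha> \<in> set (remove1 \<alpha> as)")
    case False
    then have "\<alpha> \<notin># mset as - {#\<alpha>#}" by (simp flip: mset_remove1)
    then have "count (mset as) \<alpha> \<le> 1" by (simp add: not_in_iff)
    moreover have "count (mset as) \<alpha> > 0" using \<alpha>(1) by simp
    ultimately have "Polynomial.order \<alpha> (char_poly ?A) = 1" unfolding ord by linarith
    then obtain e where "eigenvalue ?A e" "e \<noteq> \<alpha>" "\<not> cmod e < cmod \<alpha>"
      using np \<alpha>(1) ev unfolding proximal_def Let_def by blast
    then show ?thesis using max[of e] ev by (intro bexI[of _ e]) (auto simp: in_set_remove1)
  qed auto
  then obtain \<mu> where \<mu>: "\<mu> \<in> set (remove1 \<alpha> as)" "cmod \<mu> = cmod \<alpha>" by blast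
  \<comment> \<open>The roots are permuted so that \<alpha> and \<mu> come first, the order in which
    the triangularization is to display them.\<close>
  have "\<alpha> \<in># mset as" "\<mu> \<in># mset as - {#\<alpha>#}"
    using \<alpha>(1) \<mu>(1) by (simp_all flip: mset_remove1)
  then have "mset as = mset (\<alpha> # \<mu> # remove1 \<mu> (remove1 \<alpha> as))"
    using insert_DiffM[of \<alpha> "mset as"] insert_DiffM[of \<mu> "mset as - {#\<alpha>#}"] by simp
  then have "char_poly ?A = (\<Prod>e\<leftarrow>\<alpha> # \<mu> # remove1 \<mu> (remove1 \<alpha> as). [:- e, 1:])"
    unfolding cp prod_mset_prod_list[symmetric] mset_map by simp
  then show thesis using that \<mu>(2) \<alpha>(1) ev max by blast
qed

section \<open>Exponential against polynomial growth\<close>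

lemma exp_not_le_power:
  fixes a H :: real
  assumes a: "0 < a" and le: "\<And>N. 0 < N \<Longrightarrow> exp (a * real N) \<le> H * real N ^ p"
  shows False
proof -
  have "((\<lambda>x. x ^ p / exp x) \<longlongrightarrow> 0) (at_top :: real filter)"
    by (rule tendsto_power_div_exp_0)
  moreover have "filterlim (\<lambda>N. a * real N) at_top sequentially"
    using a by (intro filterlim_tendsto_pos_mult_at_top[OF tendsto_const]) (auto simp: filterlim_real_sequentially)
  ultimately have "((\<lambda>N. (a * real N) ^ p / exp (a * real N)) \<longlongrightarrow> 0) sequentially"
    by (rule filterlim_compose)
  \<comment> \<open>This factor turns the quotient into \<open>H * N ^ p / exp (a * N)\<close>,
    which is thus eventually below 1.\<close>
  then have "((\<lambda>N. H / a ^ p * ((a * real N) ^ p / exp (a * real N))) \<longlongrightarrow> H / a ^ p * 0) sequentially"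
    by (intro tendsto_mult_left)
  then have "eventually (\<lambda>N. H / a ^ p * ((a * real N) ^ p / exp (a * real N)) < 1) sequentially"
    by (rule order_tendstoD) simp
  moreover have "eventually (\<lambda>N. 0 < N) sequentially" by (rule eventually_gt_at_top)
  ultimately have "eventually (\<lambda>N::nat. False) sequentially"
  proof eventually_elim
    case (elim N)
    then have "H * real N ^ p < exp (a * real N)"
      using a by (simp add: power_mult_distrib field_simps)
    with le[of N] elim show False by simp
  qed
  then show False by simp
qed

text \<open>The squared gap times the sum of squared minors is at least a constant times exp(2aN)
  r^(4N), and at most a constant times \<sigma>1^4, hence r^(4N) times a polynomial in N.
  Invertibility gives r > 0, so that r^(4N) cancels.\<close>

lemma proximal_if_exponential_singular_gap:
  fixes A :: "real mat"
  assumes A: "A \<in> carrier_mat n n" and n: "2 \<le> n" and inv: "det A \<noteq> 0"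
    and c: "0 < c" and a: "0 < a"
    and gap: "\<And>N. c * exp (a * real N) \<le> singular_value 1 (A ^\<^sub>m N) / singular_value 2 (A ^\<^sub>m N)"
  shows "proximal A"
proof (rule ccontr)
  assume np: "\<not> proximal A"
  obtain \<alpha> \<mu> es where cp: "char_poly (map_mat complex_of_real A) = (\<Prod>e\<leftarrow>\<alpha> # \<mu> # es. [:- e, 1:])"
    and mod: "cmod \<mu> = cmod \<alpha>" and ev: "eigenvalue (map_mat complex_of_real A) \<alpha>"
    and max: "\<And>e. eigenvalue (map_mat complex_of_real A) e \<Longrightarrow> cmod e \<le> cmod \<alpha>"
    by (rule not_proximal_cases[OF A _ np]) (use n in auto)
  let ?A = "map_mat complex_of_real A"
  have Ac: "?A \<in> carrier_mat n n" using A by simp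
  define r where "r = cmod \<alpha>"
  have "\<alpha> \<noteq> 0"
  proof
    assume "\<alpha> = 0"
    from ev obtain v where v: "v \<in> carrier_vec n" "v \<noteq> 0\<^sub>v n" "?A *\<^sub>v v = 0 \<cdot>\<^sub>v v"
      using A \<open>\<alpha> = 0\<close> unfolding eigenvalue_def eigenvector_def by auto
    then have "?A *\<^sub>v v = 0\<^sub>v n" by auto
    then have "det ?A = 0" using det_0_iff_vec_prod_zero[OF Ac] v by blast
    then show False using inv by simp
  qed
  then have r: "0 < r" unfolding r_def by simp
  let ?D = "\<lambda>N. \<Sum>k<n. \<Sum>l<n. \<Sum>i<n. \<Sum>j<n.
      ((A ^\<^sub>m N) $$ (k, i) * (A ^\<^sub>m N) $$ (l, j) - (A ^\<^sub>m N) $$ (k, j) * (A ^\<^sub>m N) $$ (l, i))\<^sup>2"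
  obtain \<delta> where \<delta>: "0 < \<delta>" and D: "\<And>N. \<delta> * (r * r) ^ (2 * N) \<le> ?D N"
    using sum_squared_minors_pow_ge[OF A cp] unfolding mod r_def[symmetric] by blast
  obtain K p where K: "0 < K" and growth: "\<And>k i j. 0 < k \<Longrightarrow> i < n \<Longrightarrow> j < n \<Longrightarrow>
      cmod ((?A ^\<^sub>m k) $$ (i, j)) \<le> r ^ k * (K * real k ^ p)"
  proof (rule pow_mat_growth[OF Ac _ r])
    show "0 < n" using n by simp
  qed (use max r_def in auto)
  \<comment> \<open>In the constant, 2 n^2 comes from the bound on minors, n^4 K^4 from \<sigma>1^4,
    and c^2 \<delta> from the squared gap and the lower bound on minors.\<close>
  have main: "exp ((2 * a) * real N) \<le> (2 * (real n) ^ 6 * K ^ 4 / (c\<^sup>2 * \<delta>)) * real N ^ (4 * p)"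
    if N: "0 < N" for N
  proof -
    let ?M = "A ^\<^sub>m N" and ?g = "r ^ N * (K * real N ^ p)"
    let ?s1 = "singular_value 1 ?M" and ?s2 = "singular_value 2 ?M"
    have M: "?M \<in> carrier_mat n n" using A by simp
    have entry: "\<bar>?M $$ (k, i)\<bar> \<le> ?g" if "k < n" "i < n" for k i
      using growth[OF N that] of_real_hom.mat_hom_pow[OF A, of N, where ?'a = complex, symmetric] that A M
      by simp
    have "?s1\<^sup>2 \<le> (\<Sum>i<n. \<Sum>k<n. (?M $$ (k, i))\<^sup>2)"
      by (rule singular_values_minors(1)[OF M n])
    also have "\<dots> \<le> (\<Sum>i<n. \<Sum>k<n. ?g\<^sup>2)"
      using entry by (intro sum_mono) (auto simp: abs_le_square_iff[symmetric] intro: order_trans[OF _ abs_ge_self])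
    also have "\<dots> = (real n * ?g)\<^sup>2" by (simp add: power2_eq_square)
    finally have s1: "?s1\<^sup>2 \<le> (real n * ?g)\<^sup>2" .
    \<comment> \<open>Since \<open>x / 0 = 0\<close>, the positive lower bound on the quotient
      excludes a vanishing \<open>?s2\<close>.\<close>
    have q: "0 < ?s1 / ?s2" using gap[of N] c by (smt (verit) exp_gt_zero mult_pos_pos)
    then have s2: "?s2 \<noteq> 0" by auto
    have "c\<^sup>2 * exp ((2 * a) * real N) * (\<delta> * (r * r) ^ (2 * N)) \<le> (?s1 / ?s2)\<^sup>2 * ?D N"
    proof (intro mult_mono D)
      have "(c * exp (a * real N))\<^sup>2 \<le> (?s1 / ?s2)\<^sup>2"
        using gap[of N] c by (intro power_mono) auto
      then show "c\<^sup>2 * exp ((2 * a) * real N) \<le> (?s1 / ?s2)\<^sup>2"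
        by (simp add: power_mult_distrib exp_double[symmetric] mult.assoc)
    qed (use \<delta> r in auto)
    also have "\<dots> \<le> (?s1 / ?s2)\<^sup>2 * (2 * (real n)\<^sup>2 * (?s1 * ?s2)\<^sup>2)"
      by (intro mult_left_mono singular_values_minors(2)[OF M n]) auto
    \<comment> \<open>The product (\<sigma>1/\<sigma>2)^2 (\<sigma>1 \<sigma>2)^2 no longer contains
      \<sigma>2.\<close>
    also have "\<dots> = 2 * (real n)\<^sup>2 * (?s1\<^sup>2 * ?s1\<^sup>2)"
      using s2 by (simp add: field_simps power2_eq_square)
    also have "\<dots> \<le> 2 * (real n)\<^sup>2 * ((real n * ?g)\<^sup>2 * (real n * ?g)\<^sup>2)"
      using s1 by (intro mult_left_mono mult_mono) auto
    also have "\<dots> = (2 * real n ^ 6 * K ^ 4 * real N ^ (4 * p)) * (r * r) ^ (2 * N)"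
    proof -
      have N4: "real N ^ (4 * p) = (real N ^ p) ^ 4" by (simp add: mult.commute flip: power_mult)
      have r4: "(r * r) ^ (2 * N) = (r ^ N) ^ 4"
        by (simp add: mult.commute flip: power_mult power_add power2_eq_square)
      \<comment> \<open>A polynomial identity, applied with \<open>x\<close> the dimension,
        \<open>y = r ^ N\<close> and \<open>u = real N ^ p\<close>.\<close>
      have "2 * x\<^sup>2 * ((x * (y * (K * u)))\<^sup>2 * (x * (y * (K * u)))\<^sup>2) = 2 * x ^ 6 * K ^ 4 * u ^ 4 * y ^ 4"
        for x y u :: real
        by (simp add: eval_nat_numeral)
      then show ?thesis unfolding N4 r4 by blast
    qed
    finally have "(c\<^sup>2 * exp ((2 * a) * real N) * \<delta>) * (r * r) ^ (2 * N)
        \<le> (2 * real n ^ 6 * K ^ 4 * real N ^ (4 * p)) * (r * r) ^ (2 * N)"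
      by (simp only: mult.assoc)
    then have "c\<^sup>2 * exp ((2 * a) * real N) * \<delta> \<le> 2 * real n ^ 6 * K ^ 4 * real N ^ (4 * p)"
      by (rule mult_right_le_imp_le) (use r in simp)
    then show ?thesis using c \<delta> by (simp add: field_simps)
  qed
  show False by (rule exp_not_le_power[OF _ main]) (use a in auto)
qed

section \<open>Representations\<close>

lemma hom_GL_pow:
  assumes "group G" "\<rho> \<in> hom G (GL d)" "x \<in> carrier G"
  shows "\<rho> (x [^]\<^bsub>G\<^esub> (N::nat)) = \<rho> x ^\<^sub>m N"
proof -
  interpret R: ring "ring_mat TYPE(real) d ()" by (rule ring_mat)
  have "group (GL d)" unfolding GL_def by (rule R.units_group)
  then interpret h: group_hom G "GL d" \<rho>
    using assms by (simp add: group_hom_def group_hom_axioms_def)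
  have c: "\<rho> x \<in> carrier_mat d d"
    using h.hom_closed[OF assms(3)] unfolding GL_def by (auto simp: units_of_def Units_def ring_mat_simps)
  have one: "\<one>\<^bsub>GL d\<^esub> = 1\<^sub>m d" and mult: "\<And>U V. U \<otimes>\<^bsub>GL d\<^esub> V = U * V"
    by (simp_all add: GL_def units_of_def ring_mat_simps)
  have "\<rho> x [^]\<^bsub>GL d\<^esub> N = \<rho> x ^\<^sub>m N"
  proof (induction N)
    case 0
    show ?case using c by (simp add: one)
  next
    case (Suc N)
    then show ?case by (simp add: mult)
  qed
  then show ?thesis using h.hom_nat_pow[OF assms(3)] by simp
qed


text \<open>\<open>2 \<le> d\<close> ensures that a second singular value exists. If
  \<open>\<P>\<close> is empty, no element is peripheral, not even the identity, whose image has the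
  eigenvalue 1 with multiplicity \<open>d\<close>; the last assumption excludes this case.\<close>

theorem proposition4p6:
  fixes G :: "('g, 'm) monoid_scheme" and S :: "'g set" and \<P> :: "'g set set"
    and d :: nat and \<rho> :: "'g \<Rightarrow> real mat" and \<gamma> :: 'g
  assumes "group_with_peripherals G S \<P>"
    and "2 \<le> d"
    and "\<rho> \<in> hom G (GL d)"
    and "group_with_peripherals.one_almost_dominated G S \<P> \<rho>"
    and "\<gamma> \<in> carrier G"
    and "\<not> group_with_peripherals.peripheral G \<P> \<gamma>"
    and "\<P> = {} \<Longrightarrow> \<gamma> \<noteq> \<one>\<^bsub>G\<^esub>"
  shows "proximal (\<rho> \<gamma>)"
proof -
  interpret group_with_peripherals G S \<P> by (rule assms(1))
  have "\<gamma> \<noteq> \<one>\<^bsub>G\<^esub>"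
  proof
    assume \<gamma>: "\<gamma> = \<one>\<^bsub>G\<^esub>"
    then obtain P where P: "P \<in> \<P>" using assms(7) by auto
    have "\<one>\<^bsub>G\<^esub> \<in> P" using subgroup.one_closed[OF P_subgroup[OF P]] .
    then have "\<one>\<^bsub>G\<^esub> \<in> (\<one>\<^bsub>G\<^esub> <#\<^bsub>G\<^esub> P) #>\<^bsub>G\<^esub> inv\<^bsub>G\<^esub> \<one>\<^bsub>G\<^esub>"
      by (force simp: l_coset_def r_coset_def)
    then show False using assms(6) P \<gamma> unfolding peripheral_def by blast
  qed
  then have "\<forall>k>0. \<gamma> [^]\<^bsub>G\<^esub> (k::nat) \<noteq> \<one>\<^bsub>G\<^esub>" using torsion_free assms(5) by blast
  moreover have dom: RH "\<exists>C>0. \<exists>\<mu>>0. \<forall>x\<in>carrier G.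
      singular_value 1 (\<rho> x) / singular_value 2 (\<rho> x) \<ge> C * exp (\<mu> * real (cusped_length x))"
    using assms(4) unfolding one_almost_dominated_def by auto
  ultimately obtain \<nu> where \<nu>: "0 < \<nu>"
    and undist: "\<And>n::int. \<nu> * real_of_int \<bar>n\<bar> \<le> real (cusped_length (\<gamma> [^]\<^bsub>G\<^esub> n))"
    using assms(5,6) unfolding RH_def non_distortion_def by blast
  obtain C \<mu> where C: "0 < C" and \<mu>: "0 < \<mu>" and gap: "\<And>x. x \<in> carrier G \<Longrightarrow>
      C * exp (\<mu> * real (cusped_length x)) \<le> singular_value 1 (\<rho> x) / singular_value 2 (\<rho> x)"
    using dom(2) by blast
  have "\<rho> \<gamma> \<in> carrier (GL d)" using assms(3,5) unfolding hom_def by auto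
  then have unit: "\<rho> \<gamma> \<in> Units (ring_mat TYPE(real) d ())"
    unfolding GL_def by (simp add: units_of_def)
  show ?thesis
  proof (rule proximal_if_exponential_singular_gap[OF _ assms(2) unit_imp_det_non_zero[OF unit] C])
    show "\<rho> \<gamma> \<in> carrier_mat d d" using unit by (simp add: Units_def ring_mat_simps)
    \<comment> \<open>Domination has rate \<mu> in the cusped length, and non-distortion bounds the
      cusped length of the N-th power below by \<nu> N.\<close>
    show "0 < \<mu> * \<nu>" using \<mu> \<nu> by simp
    fix N
    have "\<nu> * real N \<le> real (cusped_length (\<gamma> [^]\<^bsub>G\<^esub> N))"
      using undist[of "int N"] by (simp add: int_pow_int)
    then have "C * exp (\<mu> * \<nu> * real N) \<le> C * exp (\<mu> * real (cusped_length (\<gamma> [^]\<^bsub>G\<^esub> N)))"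
      using C \<mu> by (simp add: mult.assoc)
    also have "\<dots> \<le> singular_value 1 (\<rho> \<gamma> ^\<^sub>m N) / singular_value 2 (\<rho> \<gamma> ^\<^sub>m N)"
      using gap[of "\<gamma> [^]\<^bsub>G\<^esub> N"] assms(5) hom_GL_pow[OF is_group assms(3,5)] by simp
    finally show "C * exp (\<mu> * \<nu> * real N)
        \<le> singular_value 1 (\<rho> \<gamma> ^\<^sub>m N) / singular_value 2 (\<rho> \<gamma> ^\<^sub>m N)" .
  qed
qed

end
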